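(* Let $(\mathfrak g,[\,,\,])$ be a finite-dimensional real semisimple Lie algebra. Then every PostLie algebra structure $(\mathfrak g,[\,,\,],\circ)$ whose bracket is the given bracket of $\mathfrak g$ is of the form $x\circ y=[f(x),y]$ for all $x,y\in\mathfrak g$, where $f:\mathfrak g\to\mathfrak g$ is a Rota–Baxter operator of weight $1$.
   Context: A PostLie algebra is a vector space $L$ with bilinear $\circ,[\,,\,]$ satisfying, for all $x,y,z$: $[x,y]=-[y,x]$; $[[x,y],z]+[[z,x],y]+[[y,z],x]=0$; $z\circ(y\circ x)-y\circ(z\circ x)+(y\circ z)\circ x-(z\circ y)\circ x+[y,z]\circ x=0$; $z\circ[x,y]-[z\circ x,y]-[x,z\circ y]=0$. A Rota–Baxter operator of weight $\lambda$ on a Lie algebra $\mathfrak g$ is a linear $f:\mathfrak g\to\mathfrak g$ with $[f(x),f(y)]=f([f(x),y]+[x,f(y)]+\lambda[x,y])$ for all $x,y$. *)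

theory Defs
  imports "HOL-Analysis.Analysis"
begin

definition lie_algebra :: "('a::real_vector \<Rightarrow> 'a \<Rightarrow> 'a) \<Rightarrow> bool" where
  "lie_algebra br \<longleftrightarrow> bilinear br
     \<and> (\<forall>x y. br x y = - br y x)
     \<and> (\<forall>x y z. br (br x y) z + br (br z x) y + br (br y z) x = 0)"

definition fin_dim :: "'a::real_vector itself \<Rightarrow> bool" where
  "fin_dim _ \<longleftrightarrow> (\<exists>B::'a set. finite B \<and> span B = UNIV)"

definition lie_ideal :: "('a::real_vector \<Rightarrow> 'a \<Rightarrow> 'a) \<Rightarrow> 'a set \<Rightarrow> bool" where
  "lie_ideal br I \<longleftrightarrow> subspace I \<and> (\<forall>x i. i \<in> I \<longrightarrow> br x i \<in> I)"

fun derived_series :: "('a::real_vector \<Rightarrow> 'a \<Rightarrow> 'a) \<Rightarrow> 'a set \<Rightarrow> nat \<Rightarrow> 'a set" where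
  "derived_series br I 0 = I"
| "derived_series br I (Suc k) =
     span {br a b | a b. a \<in> derived_series br I k \<and> b \<in> derived_series br I k}"

definition solvable_lie :: "('a::real_vector \<Rightarrow> 'a \<Rightarrow> 'a) \<Rightarrow> 'a set \<Rightarrow> bool" where
  "solvable_lie br I \<longleftrightarrow> (\<exists>k. derived_series br I k = {0})"

definition semisimple_lie :: "('a::real_vector \<Rightarrow> 'a \<Rightarrow> 'a) \<Rightarrow> bool" where
  "semisimple_lie br \<longleftrightarrow> lie_algebra br
     \<and> (\<forall>I. lie_ideal br I \<and> solvable_lie br I \<longrightarrow> I = {0})"

definition postlie :: "('a::real_vector \<Rightarrow> 'a \<Rightarrow> 'a) \<Rightarrow> ('a \<Rightarrow> 'a \<Rightarrow> 'a) \<Rightarrow> bool" where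
  "postlie br circ \<longleftrightarrow> lie_algebra br \<and> bilinear circ
     \<and> (\<forall>x y z. circ z (circ y x) - circ y (circ z x) + circ (circ y z) x
                 - circ (circ z y) x + circ (br y z) x = 0)
     \<and> (\<forall>x y z. circ z (br x y) - br (circ z x) y - br x (circ z y) = 0)"

definition rota_baxter :: "('a::real_vector \<Rightarrow> 'a \<Rightarrow> 'a) \<Rightarrow> real \<Rightarrow> ('a \<Rightarrow> 'a) \<Rightarrow> bool" where
  "rota_baxter br w f \<longleftrightarrow> linear f
     \<and> (\<forall>x y. br (f x) (f y) = f (br (f x) y + br x (f y) + w *\<^sub>R br x y))"

end

theory Submission
  imports Defs "HOL-Computational_Algebra.Fundamental_Theorem_Algebra"
begin

text \<open>
  Left multiplications \<open>y \<mapsto> x \<circ> y\<close> of a PostLie structure are derivations of the bracket. Derivations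
  of a semisimple Lie algebra are inner, so \<open>x \<circ> y = [f x, y]\<close>; since the centre vanishes, \<open>f\<close> is
  unique, hence linear, and the remaining PostLie axiom becomes the Rota--Baxter identity.

  Inner derivations come from nondegeneracy of the Killing form. Its kernel is an ideal \<open>K\<close>; let
  \<open>M\<close> be the perfect subalgebra at which the derived series of \<open>K\<close> stabilises. For \<open>x \<in> M\<close> let \<open>S\<close>
  act on the generalized eigenspaces of \<open>ad x\<close> by the conjugate eigenvalues. Then \<open>S\<close> is a
  derivation, and since \<open>x\<close> is a sum of commutators in \<open>M\<close>, the trace of \<open>ad x S\<close>, which is the sum of the
  \<open>|\<xi>|\<^sup>2\<close>, reduces to values of the Killing form on \<open>M\<close> and vanishes. So \<open>ad x\<close> is nilpotent for
  all \<open>x \<in> M\<close>, and by Engel's argument a nonzero such \<open>M\<close> would not be perfect. Thus \<open>K\<close> is a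
  solvable ideal, i.e. zero.
\<close>

section \<open>Bases and traces\<close>

definition is_basis :: "'a::real_vector set \<Rightarrow> bool" where
  "is_basis B \<longleftrightarrow> finite B \<and> independent B \<and> span B = UNIV"

lemma fin_dim_basis_from:
  fixes S :: "'a::real_vector set"
  assumes "fin_dim TYPE('a)" and "span S = UNIV"
  obtains B where "B \<subseteq> S" "is_basis B"
proof -
  obtain B where B: "B \<subseteq> S" "independent B" "S \<subseteq> span B"
    using real_vector.maximal_independent_subset[of S] by blast
  obtain C :: "'a set" where C: "finite C" "span C = UNIV"
    using assms(1) unfolding fin_dim_def by blast
  have "finite B"
    using real_vector.independent_span_bound[OF C(1) B(2)] C(2) by simp
  moreover have "span B = UNIV"
    using B(3) assms(2) by (metis span_mono span_span top.extremum_uniqueI)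
  ultimately show thesis using B that unfolding is_basis_def by blast
qed

lemma fin_dim_basis:
  assumes "fin_dim TYPE('a::real_vector)"
  obtains B :: "'a::real_vector set" where "is_basis B"
  using fin_dim_basis_from[OF assms, of UNIV] by (metis span_UNIV)

lemma basis_expansion:
  assumes "is_basis B"
  shows "(\<Sum>b\<in>B. representation B v b *\<^sub>R b) = v"
  using assms real_vector.sum_representation_eq[of B v B] unfolding is_basis_def by auto

lemma representation_linear:
  assumes "is_basis B" and "linear F"
  shows "linear (\<lambda>v. representation B (F v) b)"
  using assms unfolding is_basis_def
  by (intro linearI) (simp_all add: linear_add linear_scale real_vector.representation_add real_vector.representation_scale)

lemma linear_basis_expansion:
  fixes \<phi> :: "'a::real_vector \<Rightarrow> real"
  assumes B: "is_basis B" and \<phi>: "linear \<phi>"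
  shows "\<phi> v = (\<Sum>b\<in>B. representation B v b * \<phi> b)"
proof -
  have "\<phi> v = \<phi> (\<Sum>b\<in>B. representation B v b *\<^sub>R b)"
    by (simp only: basis_expansion[OF B])
  also have "\<dots> = (\<Sum>b\<in>B. representation B v b * \<phi> b)"
    unfolding linear_sum[OF \<phi>] linear_scale[OF \<phi>] by simp
  finally show ?thesis .
qed

text \<open>A basis of \<open>U\<close> stays independent after adding a vector of \<open>W\<close>
  outside \<open>U\<close>, and then extends to a basis of \<open>W\<close>; finite dimension keeps
  the cardinalities finite.\<close>

lemma dim_strict_mono:
  fixes U W :: "'a::real_vector set"
  assumes "fin_dim TYPE('a)" "subspace U" "subspace W" "U \<subset> W"
  shows "dim U < dim W"
proof -
  obtain B :: "'a set" where B: "is_basis B" using fin_dim_basis[OF assms(1)] .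
  obtain C where C: "C \<subseteq> U" "independent C" "U \<subseteq> span C" "card C = dim U"
    using real_vector.basis_exists[of U] by blast
  have sC: "span C = U" using C assms(2) by (metis real_vector.span_minimal subset_antisym)
  obtain w where w: "w \<in> W" "w \<notin> U" using assms(4) by blast
  have wC: "w \<notin> span C" using sC w by simp
  have ind: "independent (insert w C)"
    using C(2) wC by (simp add: real_vector.independent_insert)
  have fin: "finite X" if "independent X" for X :: "'a set"
    using real_vector.independent_span_bound[of B X] B that unfolding is_basis_def by auto
  have "w \<notin> C" using wC real_vector.span_base by blast
  then have "card (insert w C) = Suc (dim U)" using C(4) fin[OF C(2)] by simp
  moreover have "card (insert w C) \<le> dim W"
  proof -
    obtain E where E: "insert w C \<subseteq> E" "E \<subseteq> W" "independent E" "W \<subseteq> span E"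
      using real_vector.maximal_independent_subset_extend[of "insert w C" W] ind w(1) C(1) assms(4) by blast
    have "card E = dim W" using real_vector.basis_card_eq_dim E by blast
    then show ?thesis using card_mono[OF fin[OF E(3)] E(1)] by simp
  qed
  ultimately show ?thesis by simp
qed

lemma subspace_decseq_stabilises:
  fixes W :: "nat \<Rightarrow> 'a::real_vector set"
  assumes "fin_dim TYPE('a)" "\<And>k. subspace (W k)" "\<And>k. W (Suc k) \<subseteq> W k"
  shows "\<exists>k. W (Suc k) = W k"
proof (rule ccontr)
  assume "\<not> ?thesis"
  then have lt: "dim (W (Suc k)) < dim (W k)" for k
    using dim_strict_mono[OF assms(1) assms(2) assms(2)] assms(3) by blast
  have "dim (W k) + k \<le> dim (W 0)" for k
    by (induction k) (use lt in \<open>auto simp: less_eq_Suc_le intro: le_trans[rotated]\<close>)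
  from this[of "Suc (dim (W 0))"] show False by simp
qed

lemma subspace_incseq_stabilises:
  fixes W :: "nat \<Rightarrow> 'a::real_vector set"
  assumes "fin_dim TYPE('a)" "\<And>k. subspace (W k)" "\<And>k. W k \<subseteq> W (Suc k)"
  shows "\<exists>k. W (Suc k) = W k"
proof (rule ccontr)
  assume "\<not> ?thesis"
  then have lt: "dim (W k) < dim (W (Suc k))" for k
    using dim_strict_mono[OF assms(1) assms(2) assms(2)] assms(3) by blast
  have "k \<le> dim (W k)" for k
    by (induction k) (use lt in \<open>auto simp: less_eq_Suc_le intro: le_trans[rotated]\<close>)
  moreover have "dim (W k) \<le> dim (UNIV :: 'a set)" for k
    using dim_strict_mono[OF assms(1) assms(2) subspace_UNIV, of k]
    by (cases "W k = UNIV") (auto simp: psubset_eq)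
  ultimately have "k \<le> dim (UNIV :: 'a set)" for k using le_trans by blast
  from this[of "Suc (dim (UNIV :: 'a set))"] show False by simp
qed

section \<open>Traces of linear endomorphisms\<close>

definition tr :: "'a::real_vector set \<Rightarrow> ('a \<Rightarrow> 'a) \<Rightarrow> real" where
  "tr B F = (\<Sum>b\<in>B. representation B (F b) b)"

text \<open>Both sides expand to the same double sum of matrix entries. Two different spaces are
  allowed, so that inclusions and projections later give the trace on a product; taking one map to
  be the identity gives basis independence.\<close>

lemma tr_commute:
  fixes F :: "'a::real_vector \<Rightarrow> 'b::real_vector"
  assumes B: "is_basis B" and C: "is_basis C" and F: "linear F" and G: "linear G"
  shows "tr B (\<lambda>v. G (F v)) = tr C (\<lambda>w. F (G w))"
proof -
  have 1: "representation B (G (F b)) b = (\<Sum>c\<in>C. representation C (F b) c * representation B (G c) b)" for b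
    by (rule linear_basis_expansion[OF C representation_linear[OF B G]])
  have 2: "representation C (F (G c)) c = (\<Sum>b\<in>B. representation B (G c) b * representation C (F b) c)" for c
    by (rule linear_basis_expansion[OF B representation_linear[OF C F]])
  show ?thesis unfolding tr_def 1 2 by (subst sum.swap) (simp add: mult.commute)
qed

lemma tr_basis_independent:
  assumes "is_basis B" "is_basis C" "linear F"
  shows "tr B F = tr C F"
  using tr_commute[OF assms linear_ident] .

lemma tr_add:
  assumes "is_basis B"
  shows "tr B (\<lambda>v. F v + G v) = tr B F + tr B G"
  using assms unfolding tr_def is_basis_def by (simp add: real_vector.representation_add sum.distrib)

lemma tr_diff:
  assumes "is_basis B"
  shows "tr B (\<lambda>v. F v - G v) = tr B F - tr B G"
  using assms unfolding tr_def is_basis_def by (simp add: real_vector.representation_diff sum_subtractf)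

lemma tr_scale:
  assumes "is_basis B"
  shows "tr B (\<lambda>v. r *\<^sub>R F v) = r * tr B F"
  using assms unfolding tr_def is_basis_def by (simp add: real_vector.representation_scale sum_distrib_left)

lemma tr_zero: "tr B (\<lambda>v. 0) = 0"
  unfolding tr_def by (simp add: real_vector.representation_zero)

lemma linear_funpow:
  fixes F :: "'a::real_vector \<Rightarrow> 'a"
  assumes "linear F" shows "linear (F ^^ n)"
proof (induction n)
  case 0 then show ?case using linear_id unfolding funpow.simps .
next
  case (Suc n) show ?case using linear_compose[OF Suc assms] unfolding funpow.simps .
qed

text \<open>The kernels of the powers of \<open>N\<close> form a flag; in a basis adapted to it the
  matrix of \<open>N\<close> is strictly triangular.\<close>

lemma tr_nilpotent:
  fixes N :: "'a::real_vector \<Rightarrow> 'a"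
  assumes B: "is_basis B" and N: "linear N" and nil: "\<And>v. (N ^^ m) v = 0"
  shows "tr B N = 0"
proof -
  have "\<exists>C. independent C \<and> span C = {v. (N ^^ k) v = 0} \<and> (\<forall>c\<in>C. representation C (N c) c = 0)" for k
  proof (induction k)
    case 0
    then show ?case by (intro exI[of _ "{}"]) (auto simp: real_vector.independent_empty)
  next
    case (Suc k)
    then obtain C where C: "independent C" "span C = {v. (N ^^ k) v = 0}"
        "\<And>c. c \<in> C \<Longrightarrow> representation C (N c) c = 0" by blast
    let ?W = "{v. (N ^^ Suc k) v = 0}"
    have sub: "subspace ?W"
      by (rule linear_subspace_kernel[OF linear_funpow[OF N]])
    have CW: "C \<subseteq> ?W"
    proof
      fix c assume "c \<in> C"
      then have "c \<in> span C" by (rule span_base)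
      then show "c \<in> ?W" using C(2) linear_0[OF N] by simp
    qed
    obtain E where E: "C \<subseteq> E" "E \<subseteq> ?W" "independent E" "?W \<subseteq> span E"
      using real_vector.maximal_independent_subset_extend[OF CW C(1)] by blast
    have span: "span E = ?W" using E sub by (meson real_vector.span_minimal subset_antisym)
    have NE: "N e \<in> span C" if "e \<in> E" for e
    proof -
      have "(N ^^ Suc k) e = 0" using that E(2) by blast
      then show ?thesis unfolding C(2) by (simp add: funpow_swap1)
    qed
    have "representation E (N e) e = 0" if "e \<in> E" for e
    proof -
      \<comment> \<open>The coordinates of \<open>N e\<close> may be taken in \<open>C\<close>: an
        old vector has zero diagonal entry by induction, and a new one does not occur at
        all.\<close>
      have eq: "representation E (N e) = representation C (N e)"
        using real_vector.representation_extend[OF E(3) NE[OF that] E(1)] .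
      show ?thesis
      proof (cases "e \<in> C")
        case True then show ?thesis using eq C(3) by simp
      next
        case False then show ?thesis using eq real_vector.representation_ne_zero by metis
      qed
    qed
    then show ?case using E(3) span by blast
  qed
  from this[of m] obtain C where C: "independent C" "span C = UNIV"
    "\<And>c. c \<in> C \<Longrightarrow> representation C (N c) c = 0" using nil by auto
  have "finite C"
    using real_vector.independent_span_bound[of B C] B C(1) unfolding is_basis_def by auto
  then have "is_basis C" using C unfolding is_basis_def by blast
  then have "tr B N = tr C N" using tr_basis_independent[OF B _ N] by blast
  also have "\<dots> = 0" unfolding tr_def using C(3) by simp
  finally show ?thesis .
qed

section \<open>Generalized eigenspaces for a complex structure\<close>

lemma partial_fraction_unit:
  fixes R :: "complex poly"
  assumes "poly R \<nu> \<noteq> 0"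
  shows "\<exists>a c. a * R + c * [:-\<nu>, 1:] ^ m = 1"
proof (induction m)
  case 0 then show ?case by (intro exI[of _ 0] exI[of _ 1]) simp
next
  case (Suc m)
  then obtain a c where ac: "a * R + c * [:-\<nu>, 1:] ^ m = 1" by blast
  have "poly (R - [:poly R \<nu>:]) \<nu> = 0" by simp
  \<comment> \<open>Replacing \<open>R\<close> by its nonzero value at \<open>\<nu>\<close> costs a
    multiple of the linear factor. Inserting \<open>?k * [:poly R \<nu>:] = 1\<close> into the
    second summand therefore raises its exponent by one.\<close>
  then obtain s where s: "R - [:poly R \<nu>:] = [:-\<nu>, 1:] * s"
    unfolding poly_eq_0_iff_dvd by (rule dvdE)
  let ?k = "[:inverse (poly R \<nu>):]"
  have k: "?k * [:poly R \<nu>:] = 1" using assms by (simp add: one_pCons)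
  have "1 = a * R + c * [:-\<nu>, 1:] ^ m * (?k * [:poly R \<nu>:])" unfolding k using ac by simp
  also have "[:poly R \<nu>:] = R - [:-\<nu>, 1:] * s" using s by (simp add: algebra_simps)
  also have "a * R + c * [:-\<nu>, 1:] ^ m * (?k * (R - [:-\<nu>, 1:] * s))
    = (a + c * [:-\<nu>, 1:] ^ m * ?k) * R + (- c * ?k * s) * [:-\<nu>, 1:] ^ Suc m"
    by (simp only: power_Suc) algebra
  finally show ?case by metis
qed

text \<open>This is the partial fraction decomposition of the reciprocal of the full product, with
  denominators cleared. Its summands, evaluated at an endomorphism, become the spectral
  projections.\<close>

lemma partial_fractions_unit:
  fixes \<Lambda> :: "complex set" and m :: "complex \<Rightarrow> nat"
  assumes "finite \<Lambda>" "\<Lambda> \<noteq> {}"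
  shows "\<exists>b. (\<Sum>\<xi>\<in>\<Lambda>. b \<xi> * (\<Prod>\<mu>\<in>\<Lambda>-{\<xi>}. [:-\<mu>, 1:] ^ m \<mu>)) = 1"
  using assms
proof (induction \<Lambda> rule: finite_ne_induct)
  case (singleton x)
  then show ?case by (intro exI[of _ "\<lambda>_. 1"]) simp
next
  case (insert \<nu> \<Lambda>)
  let ?q = "\<lambda>\<mu>. [:-\<mu>, 1:] ^ m \<mu> :: complex poly"
  from insert obtain b where b: "(\<Sum>\<xi>\<in>\<Lambda>. b \<xi> * prod ?q (\<Lambda>-{\<xi>})) = 1" by blast
  have "poly (prod ?q \<Lambda>) \<nu> \<noteq> 0"
    using insert by (auto simp: poly_prod)
  then obtain a c where ac: "a * prod ?q \<Lambda> + c * ?q \<nu> = 1"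
    using partial_fraction_unit by blast
  \<comment> \<open>The new root takes the coefficient \<open>a\<close> of the old product; the old
    coefficients acquire \<open>c\<close>, and the factor \<open>?q \<nu>\<close> completes their
    cofactors.\<close>
  define b' where "b' = (\<lambda>\<xi>. c * b \<xi>)(\<nu> := a)"
  have "b' \<xi> * prod ?q (insert \<nu> \<Lambda> - {\<xi>}) = c * ?q \<nu> * (b \<xi> * prod ?q (\<Lambda>-{\<xi>}))" if "\<xi> \<in> \<Lambda>" for \<xi>
  proof -
    have "insert \<nu> \<Lambda> - {\<xi>} = insert \<nu> (\<Lambda> - {\<xi>})" using that insert by blast
    then show ?thesis using that insert by (auto simp: b'_def algebra_simps)
  qed
  then have "(\<Sum>\<xi>\<in>\<Lambda>. b' \<xi> * prod ?q (insert \<nu> \<Lambda> - {\<xi>})) = (\<Sum>\<xi>\<in>\<Lambda>. c * ?q \<nu> * (b \<xi> * prod ?q (\<Lambda>-{\<xi>})))"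
    by (intro sum.cong) auto
  also have "\<dots> = c * ?q \<nu>" unfolding sum_distrib_left[symmetric] b by simp
  finally have "(\<Sum>\<xi>\<in>insert \<nu> \<Lambda>. b' \<xi> * prod ?q (insert \<nu> \<Lambda> - {\<xi>})) = 1"
    using insert ac by (simp add: b'_def)
  then show ?case by blast
qed

text \<open>A complex vector space is encoded as a real one with a square root \<open>J\<close> of
  -1, and \<open>T\<close> is complex-linear because it commutes with \<open>J\<close>. Dimension
  and trace remain the real ones.\<close>

locale complex_endo =
  fixes J T :: "'b::real_vector \<Rightarrow> 'b"
  assumes linear_J: "linear J" and J_J: "J (J w) = - w"
    and linear_T: "linear T" and T_J: "T (J w) = J (T w)"
begin

section \<open>Complex scalars and polynomials acting on the space\<close>

definition cscale :: "complex \<Rightarrow> 'b \<Rightarrow> 'b" where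
  "cscale c w = Re c *\<^sub>R w + Im c *\<^sub>R J w"

lemma cscale_simps [simp]:
  "cscale 0 w = 0" "cscale 1 w = w" "cscale (of_real r) w = r *\<^sub>R w"
  "cscale c 0 = 0"
  by (simp_all add: cscale_def linear_0[OF linear_J])

lemma cscale_add: "cscale c (v + w) = cscale c v + cscale c w"
  and cscale_diff: "cscale c (v - w) = cscale c v - cscale c w"
  and cscale_scaleR: "cscale c (r *\<^sub>R w) = r *\<^sub>R cscale c w"
  and cscale_add_left: "cscale (c + d) w = cscale c w + cscale d w"
  and cscale_minus_left: "cscale (- c) w = - cscale c w"
  and cscale_cscale: "cscale c (cscale d w) = cscale (c * d) w"
  by (simp_all add: cscale_def linear_add[OF linear_J] linear_diff[OF linear_J]
      linear_scale[OF linear_J] J_J algebra_simps)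

lemma linear_cscale: "linear (cscale c)"
  by (intro linearI) (simp_all add: cscale_add cscale_scaleR)

lemma T_cscale: "T (cscale c w) = cscale c (T w)"
  by (simp add: cscale_def linear_add[OF linear_T] linear_scale[OF linear_T] T_J)

text \<open>Horner's scheme for the value of \<open>p\<close> at \<open>T\<close>.\<close>

definition pact :: "complex poly \<Rightarrow> 'b \<Rightarrow> 'b" where
  "pact p = fold_coeffs (\<lambda>a F w. cscale a w + T (F w)) p (\<lambda>_. 0)"

lemma pact_0 [simp]: "pact 0 w = 0"
  by (simp add: pact_def)

lemma pact_pCons [simp]: "pact (pCons a p) w = cscale a w + T (pact p w)"
proof (cases "a = 0 \<and> p = 0")
  case True then show ?thesis by (simp add: linear_0[OF linear_T])
next
  case False
  then have "pCons a p \<noteq> 0" by simp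
  then show ?thesis using False by (auto simp: pact_def fold_coeffs_pCons_not_0_0_eq)
qed

lemma linear_pact: "linear (pact p)"
proof (induction p)
  case 0 then show ?case by (simp add: linear_zero module_hom_zero)
next
  case (pCons a p)
  then show ?case
    by (intro linearI)
      (simp_all add: cscale_add cscale_scaleR linear_add[OF linear_T] linear_scale[OF linear_T]
        linear_add[OF pCons.IH] linear_scale[OF pCons.IH] algebra_simps)
qed

lemma pact_add: "pact (p + q) w = pact p w + pact q w"
  by (induction p q rule: poly_induct2) (simp_all add: cscale_add_left linear_add[OF linear_T])

lemma pact_smult: "pact (smult c p) w = cscale c (pact p w)"
  by (induction p) (simp_all add: cscale_cscale cscale_add T_cscale)

lemma pact_mult: "pact (p * q) w = pact p (pact q w)"
  by (induction p) (simp_all add: pact_add pact_smult)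

lemma pact_sum: "pact (\<Sum>i\<in>A. p i) w = (\<Sum>i\<in>A. pact (p i) w)"
  by (induction A rule: infinite_finite_induct) (simp_all add: pact_add)

lemma pact_1 [simp]: "pact 1 w = w"
  by (simp add: one_pCons linear_0[OF linear_T])

lemma pact_commute: "pact p (pact q w) = pact q (pact p w)"
  by (metis pact_mult mult.commute)

lemma pact_monom: "pact (monom (of_real r) k) w = r *\<^sub>R (T ^^ k) w"
  by (induction k) (simp_all add: monom_0 monom_Suc linear_0[OF linear_T] linear_scale[OF linear_T])

text \<open>The spans of the first \<open>k\<close> iterates of \<open>v\<close> under
  \<open>T\<close> stop growing, so some iterate is a combination of earlier ones.\<close>

lemma exists_annihilating_poly_of_vector:
  assumes fd: "fin_dim TYPE('b)"
  shows "\<exists>p. p \<noteq> 0 \<and> pact p v = 0"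
proof -
  define W where "W k = span ((\<lambda>i. (T ^^ i) v) ` {..<k})" for k
  obtain k where k: "W (Suc k) = W k"
    using subspace_incseq_stabilises[OF fd, of W] unfolding W_def
    by (metis (no_types, lifting) span_mono image_mono lessThan_Suc subset_insertI subspace_span)
  \<comment> \<open>The vanishing of the coefficients from \<open>k\<close> on ensures that
    subtracting the monomial of degree \<open>k\<close> leaves a nonzero polynomial.\<close>
  have q: "\<exists>q. (\<forall>i\<ge>k. coeff q i = 0) \<and> w = pact q v" if "w \<in> W k" for w
    using that unfolding W_def
  proof (induction rule: span_induct_alt)
    case base then show ?case by (intro exI[of _ 0]) simp
  next
    case (step c x y)
    then obtain i q where "i < k" "x = (T ^^ i) v" "\<forall>i\<ge>k. coeff q i = 0" "y = pact q v" by auto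
    then show ?case
      by (intro exI[of _ "monom (of_real c) i + q"]) (auto simp: pact_add pact_monom)
  qed
  have "(T ^^ k) v \<in> W (Suc k)" unfolding W_def by (intro span_base) auto
  then obtain q where q: "\<forall>i\<ge>k. coeff q i = 0" "(T ^^ k) v = pact q v" using k q by blast
  let ?p = "monom (of_real (-1)) k + q"
  have "coeff ?p k \<noteq> 0" using q(1) by simp
  then have "?p \<noteq> 0" by (metis coeff_0)
  moreover have "pact ?p v = 0" unfolding pact_add pact_monom using q(2) by simp
  ultimately show ?thesis by blast
qed

text \<open>Annihilators of the vectors of a finite spanning set are multiplied together;
  polynomials in \<open>T\<close> commute, so each factor still kills its own vector.\<close>

lemma exists_annihilating_poly:
  assumes fd: "fin_dim TYPE('b)"
  shows "\<exists>p. p \<noteq> 0 \<and> (\<forall>v. pact p v = 0)"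
proof -
  obtain B :: "'b set" where B: "finite B" "span B = UNIV" using fd unfolding fin_dim_def by blast
  have "\<exists>p. p \<noteq> 0 \<and> (\<forall>v\<in>B. pact p v = 0)"
    using B(1)
  proof (induction B)
    case empty then show ?case by (intro exI[of _ 1]) simp
  next
    case (insert b B)
    then obtain p where p: "p \<noteq> 0" "\<forall>v\<in>B. pact p v = 0" by blast
    obtain q where q: "q \<noteq> 0" "pact q b = 0" using exists_annihilating_poly_of_vector[OF fd] by blast
    have "pact (p * q) v = 0" if "v \<in> insert b B" for v
      using that p q by (metis insertE linear_0 linear_pact pact_commute pact_mult)
    then show ?case using p q by (intro exI[of _ "p * q"]) auto
  qed
  then obtain p where p: "p \<noteq> 0" "\<forall>v\<in>B. pact p v = 0" by blast
  have "pact p v = 0" for v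
    using linear_eq_0_on_span[OF linear_pact, of B p v] p B by auto
  then show ?thesis using p by blast
qed

section \<open>Generalized eigenspaces and spectral projections\<close>

definition shift :: "complex \<Rightarrow> 'b \<Rightarrow> 'b" where
  "shift \<xi> w = T w - cscale \<xi> w"

definition geig :: "complex \<Rightarrow> 'b set" where
  "geig \<xi> = {w. \<exists>n. (shift \<xi> ^^ n) w = 0}"

lemma linear_shift: "linear (shift \<xi>)"
  unfolding shift_def by (intro linear_compose_sub linear_T linear_cscale)

lemma shift_cscale: "shift \<xi> (cscale c w) = cscale c (shift \<xi> w)"
  by (simp add: shift_def T_cscale cscale_diff cscale_cscale mult.commute)

lemma pact_linear_power: "pact ([:-\<xi>, 1:] ^ n) w = (shift \<xi> ^^ n) w"
proof (induction n)
  case (Suc n)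
  have "pact ([:-\<xi>, 1:] ^ Suc n) w = pact [:-\<xi>, 1:] (pact ([:-\<xi>, 1:] ^ n) w)"
    by (simp only: power_Suc pact_mult)
  then show ?case using Suc by (simp add: shift_def cscale_minus_left linear_0[OF linear_T])
qed simp

text \<open>Powers of distinct linear factors generate the unit ideal, and both kill
  \<open>w\<close>.\<close>

lemma geig_disjoint:
  assumes "\<xi> \<noteq> \<mu>" "w \<in> geig \<xi>" "w \<in> geig \<mu>"
  shows "w = 0"
proof -
  obtain n k where n: "(shift \<xi> ^^ n) w = 0" and k: "(shift \<mu> ^^ k) w = 0"
    using assms unfolding geig_def by blast
  have "poly ([:-\<xi>, 1:] ^ n) \<mu> \<noteq> 0" using assms(1) by simp
  then obtain a c where ac: "a * [:-\<xi>, 1:] ^ n + c * [:-\<mu>, 1:] ^ k = 1"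
    using partial_fraction_unit by blast
  have "w = pact (a * [:-\<xi>, 1:] ^ n + c * [:-\<mu>, 1:] ^ k) w" unfolding ac by simp
  then show ?thesis
    unfolding pact_add pact_mult pact_linear_power n k by (simp add: linear_0[OF linear_pact])
qed

text \<open>\<open>P \<xi>\<close> is the partial fraction summand of \<open>\<xi>\<close> evaluated
  at \<open>T\<close>. Multiplied by its missing linear factors it contains the whole annihilating
  product; the single exponent \<open>n\<close> serves all \<open>\<xi>\<close>.\<close>

lemma spectral_projections:
  assumes fd: "fin_dim TYPE('b)"
  obtains \<Lambda> P n where "finite \<Lambda>" "\<And>\<xi>. linear (P \<xi>)" "\<And>\<xi> p w. P \<xi> (pact p w) = pact p (P \<xi> w)"
    "\<And>\<xi> w. \<xi> \<in> \<Lambda> \<Longrightarrow> (shift \<xi> ^^ n) (P \<xi> w) = 0"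
    "\<And>w. (\<Sum>\<xi>\<in>\<Lambda>. P \<xi> w) = w"
proof -
  obtain p where p: "p \<noteq> 0" "\<And>v. pact p v = 0" using exists_annihilating_poly[OF fd] by blast
  \<comment> \<open>Zero is inserted because the partial fraction identity needs a nonempty
    set.\<close>
  define \<Lambda> where "\<Lambda> = insert 0 {z. poly p z = 0}"
  have fin: "finite \<Lambda>" using p(1) by (simp add: \<Lambda>_def poly_roots_finite)
  define n where "n = degree p"
  define q where "q \<mu> = [:-\<mu>, 1:] ^ n" for \<mu> :: complex
  have "p dvd prod q \<Lambda>"
  proof -
    have "p dvd smult (inverse (lead_coeff p)) p" by (simp add: dvd_smult)
    \<comment> \<open>Over the complex numbers \<open>p\<close> splits, and every root has order at
      most the degree \<open>n\<close>.\<close>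
    also have "smult (inverse (lead_coeff p)) p = (\<Prod>z | poly p z = 0. [:-z, 1:] ^ order z p)"
      using p(1) by (subst (2) complex_poly_decompose[symmetric]) simp
    also have "\<dots> dvd prod q {z. poly p z = 0}"
      unfolding q_def n_def using order_degree[OF p(1)] by (intro prod_dvd_prod le_imp_power_dvd)
    also have "\<dots> dvd prod q \<Lambda>"
      by (rule prod_dvd_prod_subset[OF fin]) (auto simp: \<Lambda>_def)
    finally show ?thesis .
  qed
  then have ann: "pact (prod q \<Lambda>) v = 0" for v
    by (metis dvdE mult.commute p(2) linear_0 linear_pact pact_mult)
  obtain b where b: "(\<Sum>\<xi>\<in>\<Lambda>. b \<xi> * prod q (\<Lambda>-{\<xi>})) = 1"
    using partial_fractions_unit[OF fin, of "\<lambda>_. n"] unfolding q_def \<Lambda>_def by blast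
  define P where "P \<xi> = pact (b \<xi> * prod q (\<Lambda>-{\<xi>}))" for \<xi>
  show thesis
  proof
    show "finite \<Lambda>" by fact
    show "linear (P \<xi>)" for \<xi> unfolding P_def by (rule linear_pact)
    show "P \<xi> (pact p w) = pact p (P \<xi> w)" for \<xi> p w unfolding P_def by (rule pact_commute)
    show "(\<Sum>\<xi>\<in>\<Lambda>. P \<xi> w) = w" for w
      unfolding P_def pact_sum[symmetric] b by simp
    show "(shift \<xi> ^^ n) (P \<xi> w) = 0" if "\<xi> \<in> \<Lambda>" for \<xi> w
    proof -
      have "(shift \<xi> ^^ n) (P \<xi> w) = pact (q \<xi> * (b \<xi> * prod q (\<Lambda>-{\<xi>}))) w"
        unfolding P_def q_def pact_mult pact_linear_power ..
      also have "q \<xi> * (b \<xi> * prod q (\<Lambda>-{\<xi>})) = b \<xi> * prod q \<Lambda>"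
        using fin that by (simp add: prod.remove algebra_simps)
      also have "pact \<dots> w = 0" unfolding pact_mult ann by (rule linear_0[OF linear_pact])
      finally show ?thesis .
    qed
  qed
qed

lemma bilinear_cscale:
  assumes \<beta>: "bilinear \<beta>" "\<And>u v. \<beta> (J u) v = J (\<beta> u v)" "\<And>u v. \<beta> u (J v) = J (\<beta> u v)"
  shows "\<beta> (cscale c u) v = cscale c (\<beta> u v)" "\<beta> u (cscale c v) = cscale c (\<beta> u v)"
  by (simp_all add: cscale_def bilinear_ladd[OF \<beta>(1)] bilinear_lmul[OF \<beta>(1)]
      bilinear_radd[OF \<beta>(1)] bilinear_rmul[OF \<beta>(1)] \<beta>(2,3))

text \<open>The shift by \<open>\<xi> + \<mu>\<close> obeys a Leibniz rule with the two separate
  shifts. Each application lowers one of the two exponents, so induction runs on their sum.\<close>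

lemma geig_bilinear:
  fixes \<beta> :: "'b \<Rightarrow> 'b \<Rightarrow> 'b"
  assumes \<beta>: "bilinear \<beta>" "\<And>u v. \<beta> (J u) v = J (\<beta> u v)" "\<And>u v. \<beta> u (J v) = J (\<beta> u v)"
    and deriv: "\<And>u v. T (\<beta> u v) = \<beta> (T u) v + \<beta> u (T v)"
    and u: "u \<in> geig \<xi>" and v: "v \<in> geig \<mu>"
  shows "\<beta> u v \<in> geig (\<xi> + \<mu>)"
proof -
  have sh: "shift (\<xi> + \<mu>) (\<beta> u v) = \<beta> (shift \<xi> u) v + \<beta> u (shift \<mu> v)" for u v
    by (simp add: shift_def deriv bilinear_lsub[OF \<beta>(1)] bilinear_rsub[OF \<beta>(1)] bilinear_cscale[OF \<beta>(1-3)] cscale_add_left)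
  have "(shift (\<xi> + \<mu>) ^^ k) (\<beta> u v) = 0"
    if "(shift \<xi> ^^ i) u = 0" "(shift \<mu> ^^ j) v = 0" "i + j = k" for i j k u v
    using that
  proof (induction k arbitrary: i j u v)
    case 0 then show ?case by (simp add: bilinear_lzero[OF \<beta>(1)])
  next
    case (Suc k)
    show ?case
    proof (cases "i = 0 \<or> j = 0")
      case True
      then have "\<beta> u v = 0" using Suc.prems
        by (auto simp: bilinear_lzero[OF \<beta>(1)] bilinear_rzero[OF \<beta>(1)])
      then show ?thesis
        by (simp add: linear_0[OF linear_shift] linear_0[OF linear_funpow[OF linear_shift]])
    next
      case False
      then obtain i' j' where ij: "i = Suc i'" "j = Suc j'" by (meson not0_implies_Suc)
      have "(shift (\<xi> + \<mu>) ^^ k) (\<beta> (shift \<xi> u) v) = 0"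
        using Suc.prems ij by (intro Suc.IH[of i' _ j]) (auto simp: funpow_swap1)
      moreover have "(shift (\<xi> + \<mu>) ^^ k) (\<beta> u (shift \<mu> v)) = 0"
        using Suc.prems ij by (intro Suc.IH[of i _ j']) (auto simp: funpow_swap1)
      ultimately have "(shift (\<xi> + \<mu>) ^^ k) (shift (\<xi> + \<mu>) (\<beta> u v)) = 0"
        unfolding sh linear_add[OF linear_funpow[OF linear_shift]] by simp
      then show ?thesis by (simp add: funpow_swap1)
    qed
  qed
  then show ?thesis using u v unfolding geig_def by blast
qed

text \<open>\<open>S\<close> acts on the generalized eigenspace of \<open>\<xi>\<close> as \<open>cnj \<xi>\<close>. Conjugation is additive, so
  \<open>S\<close> is a derivation whenever \<open>T\<close> is; and \<open>T S\<close> has the eigenvalues \<open>|\<xi>|\<^sup>2\<close>, so its trace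
  vanishes only if all \<open>\<xi>\<close> do. No multiplicities are needed: \<open>T S\<close> differs by a nilpotent map from a
  map that is diagonal in a basis of generalized eigenvectors.\<close>

lemma conjugate_semisimple_part:
  assumes fd: "fin_dim TYPE('b)" and B: "is_basis (B :: 'b set)"
  obtains S where "linear S"
    "\<And>\<beta> u v. \<lbrakk>bilinear \<beta>; \<And>u v. \<beta> (J u) v = J (\<beta> u v); \<And>u v. \<beta> u (J v) = J (\<beta> u v);
       \<And>u v. T (\<beta> u v) = \<beta> (T u) v + \<beta> u (T v)\<rbrakk> \<Longrightarrow> S (\<beta> u v) = \<beta> (S u) v + \<beta> u (S v)"
    "tr B (\<lambda>w. T (S w)) = 0 \<Longrightarrow> \<exists>n. \<forall>w. (T ^^ n) w = 0"
proof -
  obtain \<Lambda> P n where fin: "finite \<Lambda>" and linP: "\<And>\<xi>. linear (P \<xi>)"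
    and comm: "\<And>\<xi> p w. P \<xi> (pact p w) = pact p (P \<xi> w)"
    and nil: "\<And>\<xi> w. \<xi> \<in> \<Lambda> \<Longrightarrow> (shift \<xi> ^^ n) (P \<xi> w) = 0"
    and sumP: "\<And>w. (\<Sum>\<xi>\<in>\<Lambda>. P \<xi> w) = w"
    using spectral_projections[OF fd] by blast
  have Pgeig: "P \<xi> w \<in> geig \<xi>" if "\<xi> \<in> \<Lambda>" for \<xi> w
    using nil[OF that] unfolding geig_def by blast
  \<comment> \<open>\<open>P \<xi>\<close> commutes with polynomials in \<open>T\<close>, so
    \<open>P \<xi> w\<close> lies in two distinct generalized eigenspaces.\<close>
  have P_off: "P \<xi> w = 0" if w: "w \<in> geig \<nu>" "\<xi> \<noteq> \<nu>" "\<xi> \<in> \<Lambda>" for \<xi> \<nu> w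
  proof -
    obtain k where "(shift \<nu> ^^ k) w = 0" using w unfolding geig_def by blast
    then have "(shift \<nu> ^^ k) (P \<xi> w) = 0"
      using comm[of \<xi> "[:-\<nu>, 1:] ^ k" w] unfolding pact_linear_power by (simp add: linear_0[OF linP])
    then have "P \<xi> w \<in> geig \<nu>" unfolding geig_def by blast
    then show ?thesis using geig_disjoint[OF w(2)] Pgeig[OF w(3)] by blast
  qed
  define spec where "spec f w = (\<Sum>\<xi>\<in>\<Lambda>. cscale (f \<xi>) (P \<xi> w))" for f w
  have lin_spec: "linear (spec f)" for f
    unfolding spec_def
    by (intro linear_compose_sum ballI linear_compose[OF linP linear_cscale, unfolded o_def]) 
  \<comment> \<open>This covers \<open>\<nu>\<close> outside \<open>\<Lambda>\<close> too, which
    matters because the sum of two elements of \<open>\<Lambda>\<close> may leave it.\<close>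
  have spec_geig: "spec f w = cscale (f \<nu>) w" if "w \<in> geig \<nu>" for f w \<nu>
  proof -
    have "spec f w = (\<Sum>\<xi>\<in>\<Lambda>. cscale (f \<nu>) (P \<xi> w))"
      unfolding spec_def using P_off[OF that] by (intro sum.cong refl) (metis cscale_simps(4))
    also have "\<dots> = cscale (f \<nu>) (\<Sum>\<xi>\<in>\<Lambda>. P \<xi> w)" by (simp add: linear_sum[OF linear_cscale])
    finally show ?thesis by (simp add: sumP)
  qed
  define S where "S = spec cnj"
  define D where "D = spec (\<lambda>\<xi>. of_real ((cmod \<xi>)\<^sup>2))"
  have linS: "linear S" and linD: "linear D" unfolding S_def D_def by (rule lin_spec)+
  show thesis
  proof (rule that[of S])
    show "linear S" by fact
  next
    fix \<beta> u v
    assume \<beta>: "bilinear \<beta>" "\<And>u v. \<beta> (J u) v = J (\<beta> u v)" "\<And>u v. \<beta> u (J v) = J (\<beta> u v)"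
       "\<And>u v. T (\<beta> u v) = \<beta> (T u) v + \<beta> u (T v)"
    have hom: "S (\<beta> u v) = \<beta> (S u) v + \<beta> u (S v)" if "u \<in> geig \<xi>" "v \<in> geig \<mu>" for u v \<xi> \<mu>
      unfolding S_def spec_geig[OF geig_bilinear[OF \<beta> that]] spec_geig[OF that(1)] spec_geig[OF that(2)]
      by (simp add: bilinear_cscale[OF \<beta>(1-3)] cscale_add_left)
    have lr: "linear (\<beta> u)" "linear (\<lambda>v. \<beta> v u)" for u using \<beta>(1) unfolding bilinear_def by auto
    \<comment> \<open>The Leibniz rule passes from generalized eigenvectors to all vectors one
      argument at a time.\<close>
    have half: "S (\<beta> u v) = \<beta> (S u) v + \<beta> u (S v)" if u: "u \<in> geig \<xi>" for u v \<xi>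
    proof -
      have "S (\<beta> u (\<Sum>\<mu>\<in>\<Lambda>. P \<mu> v)) = (\<Sum>\<mu>\<in>\<Lambda>. S (\<beta> u (P \<mu> v)))"
        by (simp add: linear_sum[OF lr(1)] linear_sum[OF linS])
      also have "\<dots> = (\<Sum>\<mu>\<in>\<Lambda>. \<beta> (S u) (P \<mu> v) + \<beta> u (S (P \<mu> v)))"
        using hom[OF u Pgeig] by (intro sum.cong) auto
      also have "\<dots> = \<beta> (S u) (\<Sum>\<mu>\<in>\<Lambda>. P \<mu> v) + \<beta> u (S (\<Sum>\<mu>\<in>\<Lambda>. P \<mu> v))"
        by (simp add: sum.distrib linear_sum[OF lr(1)] linear_sum[OF linS])
      finally show ?thesis unfolding sumP .
    qed
    have "S (\<beta> (\<Sum>\<mu>\<in>\<Lambda>. P \<mu> u) v) = (\<Sum>\<mu>\<in>\<Lambda>. S (\<beta> (P \<mu> u) v))"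
      by (simp add: linear_sum[OF lr(2)] linear_sum[OF linS])
    also have "\<dots> = (\<Sum>\<mu>\<in>\<Lambda>. \<beta> (S (P \<mu> u)) v + \<beta> (P \<mu> u) (S v))"
      using half[OF Pgeig] by (intro sum.cong) auto
    also have "\<dots> = \<beta> (S (\<Sum>\<mu>\<in>\<Lambda>. P \<mu> u)) v + \<beta> (\<Sum>\<mu>\<in>\<Lambda>. P \<mu> u) (S v)"
      by (simp add: sum.distrib linear_sum[OF lr(2)] linear_sum[OF linS])
    finally show "S (\<beta> u v) = \<beta> (S u) v + \<beta> u (S v)" unfolding sumP .
  next
    assume tr0: "tr B (\<lambda>w. T (S w)) = 0"
    define N where "N w = T (S w) - D w" for w
    have linTS: "linear (\<lambda>w. T (S w))" using linear_compose[OF linS linear_T] by (simp add: o_def)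
    have linN: "linear N" unfolding N_def by (intro linear_compose_sub linTS linD)
    have "(N ^^ n) w = 0" for w
    proof -
      \<comment> \<open>On the generalized eigenspace of \<open>\<xi>\<close>, \<open>N\<close> is
        \<open>cnj \<xi>\<close> times the shift, hence nilpotent there.\<close>
      have pow: "(N ^^ k) (P \<xi> w) = cscale (cnj \<xi> ^ k) ((shift \<xi> ^^ k) (P \<xi> w))" if "\<xi> \<in> \<Lambda>" for \<xi> k
      proof (induction k)
        case (Suc k)
        let ?x = "cscale (cnj \<xi> ^ k) ((shift \<xi> ^^ k) (P \<xi> w))"
        have x: "?x = P \<xi> (pact (smult (cnj \<xi> ^ k) ([:-\<xi>, 1:] ^ k)) w)"
          unfolding comm by (simp add: pact_smult pact_linear_power)
        have xg: "?x \<in> geig \<xi>" unfolding x by (rule Pgeig[OF that])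
        have "N ?x = cscale (cnj \<xi>) (shift \<xi> ?x)"
          unfolding N_def S_def D_def spec_geig[OF xg] complex_norm_square
          by (simp add: shift_def T_cscale cscale_diff cscale_cscale mult_ac)
        then show ?case using Suc by (simp add: shift_cscale cscale_cscale)
      qed simp
      have "(N ^^ n) (\<Sum>\<xi>\<in>\<Lambda>. P \<xi> w) = (\<Sum>\<xi>\<in>\<Lambda>. (N ^^ n) (P \<xi> w))"
        by (rule linear_sum[OF linear_funpow[OF linN]])
      also have "\<dots> = 0" using pow nil by (intro sum.neutral) simp
      finally show ?thesis unfolding sumP .
    qed
    then have "tr B N = 0" by (rule tr_nilpotent[OF B linN])
    then have trD: "tr B D = 0" using tr0 unfolding N_def tr_diff[OF B] by simp
    have "span (\<Union>\<xi>\<in>\<Lambda>. geig \<xi>) = UNIV"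
    proof -
      have "w \<in> span (\<Union>\<xi>\<in>\<Lambda>. geig \<xi>)" for w
        using Pgeig by (subst sumP[symmetric]) (blast intro: span_sum span_base)
      then show ?thesis by blast
    qed
    \<comment> \<open>In a basis of generalized eigenvectors \<open>D\<close> is diagonal with
      nonnegative real entries, so trace zero forces \<open>D\<close> to vanish.\<close>
    then obtain C where C: "C \<subseteq> (\<Union>\<xi>\<in>\<Lambda>. geig \<xi>)" "is_basis C"
      using fin_dim_basis_from[OF fd] by blast
    then have "\<forall>c\<in>C. \<exists>\<xi>. c \<in> geig \<xi>" by blast
    then obtain l where l: "\<And>c. c \<in> C \<Longrightarrow> c \<in> geig (l c)" by metis
    have Dc: "D c = (cmod (l c))\<^sup>2 *\<^sub>R c" if "c \<in> C" for c
      unfolding D_def spec_geig[OF l[OF that]] by (rule cscale_simps(3))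
    have "0 = tr C D" using trD tr_basis_independent[OF B C(2) linD] by simp
    also have "\<dots> = (\<Sum>c\<in>C. (cmod (l c))\<^sup>2)"
      unfolding tr_def using C(2)
      by (intro sum.cong refl)
        (simp add: Dc is_basis_def real_vector.representation_scale real_vector.representation_basis span_base)
    finally have "\<forall>c\<in>C. (cmod (l c))\<^sup>2 = 0"
      using C(2) by (subst (asm) eq_commute, subst (asm) sum_nonneg_eq_0_iff) (auto simp: is_basis_def)
    then have D0: "D c = 0" if "c \<in> C" for c using Dc[OF that] that by simp
    have D0: "D w = 0" for w
      using linear_eq_0_on_span[OF linD, of C w] D0 C(2) by (auto simp: is_basis_def)
    \<comment> \<open>Vanishing of \<open>D\<close> leaves only the component at eigenvalue 0, where
      the shift is \<open>T\<close> itself.\<close>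
    have "(T ^^ n) (P \<xi> w) = 0" if "\<xi> \<in> \<Lambda>" for \<xi> w
    proof (cases "\<xi> = 0")
      case True
      have "shift 0 = T" by (auto simp: shift_def fun_eq_iff)
      then show ?thesis using nil[OF that, of w] True by simp
    next
      case False
      have "(cmod \<xi>)\<^sup>2 *\<^sub>R P \<xi> w = 0"
        using D0[of "P \<xi> w"] unfolding D_def spec_geig[OF Pgeig[OF that]] cscale_simps(3) .
      then show ?thesis using False by (simp add: linear_0[OF linear_funpow[OF linear_T]])
    qed
    then have "(T ^^ n) (\<Sum>\<xi>\<in>\<Lambda>. P \<xi> w) = 0" for w
      unfolding linear_sum[OF linear_funpow[OF linear_T]] by (intro sum.neutral) simp
    then show "\<exists>n. \<forall>w. (T ^^ n) w = 0" unfolding sumP by blast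
  qed
qed

end

section \<open>Subalgebras of nilpotent elements\<close>

definition lie_subalgebra :: "('a::real_vector \<Rightarrow> 'a \<Rightarrow> 'a) \<Rightarrow> 'a set \<Rightarrow> bool" where
  "lie_subalgebra br M \<longleftrightarrow> subspace M \<and> (\<forall>x\<in>M. \<forall>y\<in>M. br x y \<in> M)"

definition is_derivation :: "('a::real_vector \<Rightarrow> 'a \<Rightarrow> 'a) \<Rightarrow> ('a \<Rightarrow> 'a) \<Rightarrow> bool" where
  "is_derivation br D \<longleftrightarrow> linear D \<and> (\<forall>x y. D (br x y) = br (D x) y + br x (D y))"

lemma lie_algebraD:
  assumes "lie_algebra br"
  shows "bilinear br" "br x y = - br y x" "br x x = 0" "linear (br x)" "linear (\<lambda>z. br z x)"
    "br x (br y z) = br (br x y) z + br y (br x z)"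
proof -
  have bil: "bilinear br" and anti: "\<And>x y. br x y = - br y x"
    using assms unfolding lie_algebra_def by blast+
  show "bilinear br" "br x y = - br y x" by (fact bil, fact anti)
  have "br x x + br x x = 0" using anti[of x x] by (metis add.right_inverse)
  then show "br x x = 0" by (simp flip: scaleR_2)
  show "linear (br x)" "linear (\<lambda>z. br z x)" using bil unfolding bilinear_def by auto
  have jac: "br (br x y) z + br (br z x) y + br (br y z) x = 0"
    using assms unfolding lie_algebra_def by blast
  have 1: "br (br z x) y = br y (br x z)"
    by (metis anti bil bilinear_rneg minus_minus)
  have 2: "br (br y z) x = - br x (br y z)" by (rule anti)
  show "br x (br y z) = br (br x y) z + br y (br x z)" using jac unfolding 1 2 by simp
qed

section \<open>Maximal subalgebras and Engel's theorem\<close>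

lemma lie_subalgebra_has_maximal:
  fixes M :: "'a::real_vector set"
  assumes fd: "fin_dim TYPE('a)" and M: "subspace M" "M \<noteq> {0}" and lie: "lie_algebra br"
  obtains K where "lie_subalgebra br K" "K \<subset> M"
    "\<And>L. \<lbrakk>lie_subalgebra br L; K \<subset> L; L \<subseteq> M\<rbrakk> \<Longrightarrow> L = M"
proof -
  let ?Q = "\<lambda>K. lie_subalgebra br K \<and> K \<subset> M"
  have bot: "?Q {0}"
    using M lie_algebraD(3)[OF lie, of 0] subspace_0[OF M(1)]
    by (auto simp: lie_subalgebra_def)
  have bound: "\<forall>K. ?Q K \<longrightarrow> dim K < dim M"
    using dim_strict_mono[OF fd _ M(1)] unfolding lie_subalgebra_def by blast
  \<comment> \<open>A proper subalgebra of greatest dimension is maximal; the zero subalgebra shows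
    that there is a candidate.\<close>
  obtain K where K: "?Q K" "\<And>L. ?Q L \<Longrightarrow> dim L \<le> dim K"
    using Lattices_Big.ex_has_greatest_nat[where P = ?Q and f = dim, OF bot bound] by blast
  show thesis
  proof (rule that[of K])
    fix L assume L: "lie_subalgebra br L" "K \<subset> L" "L \<subseteq> M"
    then have "dim K < dim L"
      using dim_strict_mono[OF fd, of K L] K(1) unfolding lie_subalgebra_def by blast
    then show "L = M" using K(2)[of L] L by (metis not_le psubsetI)
  qed (use K in auto)
qed

text \<open>Since \<open>y\<close> normalises \<open>K\<close> and commutes with itself, all
  brackets fall back into \<open>K\<close>. The second claim will bound the derived algebra.\<close>

lemma lie_subalgebra_insert:
  assumes lie: "lie_algebra br" and K: "lie_subalgebra br K" and y: "\<And>k. k \<in> K \<Longrightarrow> br k y \<in> K"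
  shows "lie_subalgebra br {k + r *\<^sub>R y | k r. k \<in> K}"
    and "\<lbrakk>a \<in> {k + r *\<^sub>R y | k r. k \<in> K}; b \<in> {k + r *\<^sub>R y | k r. k \<in> K}\<rbrakk> \<Longrightarrow> br a b \<in> K"
proof -
  note bil = lie_algebraD(1)[OF lie]
  have sK: "subspace K" and cl: "\<And>a b. a \<in> K \<Longrightarrow> b \<in> K \<Longrightarrow> br a b \<in> K"
    using K unfolding lie_subalgebra_def by auto
  have y': "br y k \<in> K" if "k \<in> K" for k
    using y[OF that] lie_algebraD(2)[OF lie, of y k] subspace_neg[OF sK] by simp
  have *: "br (k + r *\<^sub>R y) (k' + r' *\<^sub>R y) \<in> K" if "k \<in> K" "k' \<in> K" for k k' r r'
    using that y y' cl sK
    by (simp add: bilinear_ladd[OF bil] bilinear_radd[OF bil] bilinear_lmul[OF bil] bilinear_rmul[OF bil]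
        lie_algebraD(3)[OF lie] subspace_add subspace_scale)
  show "br a b \<in> K" if "a \<in> {k + r *\<^sub>R y | k r. k \<in> K}" "b \<in> {k + r *\<^sub>R y | k r. k \<in> K}" for a b
    using that * by blast
  have sub: "subspace {k + r *\<^sub>R y | k r. k \<in> K}"
    unfolding subspace_def
  proof (intro conjI ballI allI)
    show "0 \<in> {k + r *\<^sub>R y |k r. k \<in> K}"
      using subspace_0[OF sK] by (intro CollectI exI[of _ 0]) simp
    fix a b c assume "a \<in> {k + r *\<^sub>R y |k r. k \<in> K}"
    then obtain k r where a: "a = k + r *\<^sub>R y" "k \<in> K" by blast
    have "c *\<^sub>R a = c *\<^sub>R k + (c * r) *\<^sub>R y" unfolding a by (simp add: algebra_simps)
    then show "c *\<^sub>R a \<in> {k + r *\<^sub>R y |k r. k \<in> K}" using subspace_scale[OF sK a(2)] by blast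
    assume "b \<in> {k + r *\<^sub>R y |k r. k \<in> K}"
    then obtain k' r' where b: "b = k' + r' *\<^sub>R y" "k' \<in> K" by blast
    have "a + b = (k + k') + (r + r') *\<^sub>R y" unfolding a b by (simp add: algebra_simps)
    then show "a + b \<in> {k + r *\<^sub>R y |k r. k \<in> K}" using subspace_add[OF sK a(2) b(2)] by blast
  qed
  have "K \<subseteq> {k + r *\<^sub>R y | k r. k \<in> K}"
    by (metis (mono_tags, lifting) add.right_neutral mem_Collect_eq scaleR_zero_left subsetI)
  then show "lie_subalgebra br {k + r *\<^sub>R y | k r. k \<in> K}"
    unfolding lie_subalgebra_def using sub * by blast
qed

lemma maximal_subalgebra_normalised:
  assumes lie: "lie_algebra br" and K: "lie_subalgebra br K" "K \<subset> M" and M: "subspace M"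
    and max: "\<And>L. \<lbrakk>lie_subalgebra br L; K \<subset> L; L \<subseteq> M\<rbrakk> \<Longrightarrow> L = M"
    and y: "y \<in> M" "y \<notin> K" "\<And>k. k \<in> K \<Longrightarrow> br k y \<in> K"
  shows "M = {k + r *\<^sub>R y | k r. k \<in> K}"
proof -
  have sK: "subspace K" using K unfolding lie_subalgebra_def by auto
  let ?L = "{k + r *\<^sub>R y | k r. k \<in> K}"
  have "K \<subseteq> ?L"
    by (metis (mono_tags, lifting) add.right_neutral mem_Collect_eq scaleR_zero_left subsetI)
  moreover have "y \<in> ?L" using subspace_0[OF sK] by (intro CollectI exI[of _ 0] exI[of _ 1]) simp
  ultimately have "K \<subset> ?L" using y(2) by blast
  moreover have "?L \<subseteq> M" using K(2) y(1) M by (auto intro!: subspace_add subspace_scale)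
  ultimately show ?thesis using max[OF lie_subalgebra_insert(1)[OF lie K(1) y(3)]] by blast
qed

text \<open>Engel's theorem for the action on the quotient \<open>W / U\<close>, phrased without quotients; the
  induction needs it for \<open>W / U\<close> equal to a subalgebra modulo a maximal proper subalgebra.\<close>

lemma engel_common_vector:
  fixes M U W :: "'a::real_vector set"
  assumes fd: "fin_dim TYPE('a)" and lie: "lie_algebra br"
    and M: "lie_subalgebra br M" and nil: "\<And>x. x \<in> M \<Longrightarrow> \<exists>n. \<forall>w. (br x ^^ n) w = 0"
    and U: "subspace U" "\<And>x u. x \<in> M \<Longrightarrow> u \<in> U \<Longrightarrow> br x u \<in> U"
    and W: "subspace W" "\<And>x w. x \<in> M \<Longrightarrow> w \<in> W \<Longrightarrow> br x w \<in> W"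
    and UW: "U \<subset> W"
  shows "\<exists>w\<in>W - U. \<forall>x\<in>M. br x w \<in> U"
  using M nil U W UW
proof (induction "dim M" arbitrary: M U W rule: less_induct)
  case less
  note bil = lie_algebraD(1)[OF lie]
  show ?case
  proof (cases "M = {0}")
    case True
    then show ?thesis using less.prems subspace_0 by (auto simp: bilinear_lzero[OF bil])
  next
    case False
    have sM: "subspace M" using less.prems(1) unfolding lie_subalgebra_def by blast
    obtain K where K: "lie_subalgebra br K" "K \<subset> M"
      and max: "\<And>L. \<lbrakk>lie_subalgebra br L; K \<subset> L; L \<subseteq> M\<rbrakk> \<Longrightarrow> L = M"
      using lie_subalgebra_has_maximal[OF fd sM False lie] by blast
    have sK: "subspace K" using K(1) unfolding lie_subalgebra_def by blast
    have dimK: "dim K < dim M" by (rule dim_strict_mono[OF fd sK sM K(2)])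
    \<comment> \<open>Induction for \<open>K\<close> acting on the quotient of \<open>M\<close> by
      \<open>K\<close> yields an element normalising \<open>K\<close>.\<close>
    have "\<exists>y\<in>M - K. \<forall>x\<in>K. br x y \<in> K"
    proof (rule less.hyps[OF dimK K(1)])
      show "\<exists>n. \<forall>w. (br x ^^ n) w = 0" if "x \<in> K" for x
        using less.prems(2) that K(2) by blast
      show "br x u \<in> K" if "x \<in> K" "u \<in> K" for x u
        using that K(1) unfolding lie_subalgebra_def by blast
      show "br x u \<in> M" if "x \<in> K" "u \<in> M" for x u
        using that K(2) less.prems(1) unfolding lie_subalgebra_def by blast
    qed fact+
    then obtain y where y: "y \<in> M" "y \<notin> K" "\<And>k. k \<in> K \<Longrightarrow> br k y \<in> K" by blast
    have M_eq: "M = {k + r *\<^sub>R y | k r. k \<in> K}"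
      by (rule maximal_subalgebra_normalised[OF lie K sM max y])
    have "\<exists>w\<in>W - U. \<forall>x\<in>K. br x w \<in> U"
    proof (rule less.hyps[OF dimK K(1)])
      show "\<exists>n. \<forall>w. (br x ^^ n) w = 0" if "x \<in> K" for x
        using less.prems(2) that K(2) by blast
      show "br x u \<in> U" if "x \<in> K" "u \<in> U" for x u
        using that K(2) less.prems(4) by blast
      show "br x u \<in> W" if "x \<in> K" "u \<in> W" for x u
        using that K(2) less.prems(6) by blast
    qed fact+
    then obtain w where w: "w \<in> W" "w \<notin> U" "\<And>x. x \<in> K \<Longrightarrow> br x w \<in> U" by blast
    \<comment> \<open>\<open>br y\<close> preserves the vectors killed by \<open>K\<close> modulo
      \<open>U\<close>, by the Jacobi identity and because \<open>y\<close> normalises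
      \<open>K\<close>.\<close>
    have inv: "(br y ^^ i) w \<in> W \<and> (\<forall>k\<in>K. br k ((br y ^^ i) w) \<in> U)" for i
    proof (induction i)
      case 0 then show ?case using w by simp
    next
      case (Suc i)
      let ?v = "(br y ^^ i) w"
      have "br k (br y ?v) \<in> U" if k: "k \<in> K" for k
      proof -
        have "br (br k y) ?v \<in> U" using Suc y(3)[OF k] by blast
        moreover have "br y (br k ?v) \<in> U" using Suc k less.prems(4) y(1) by blast
        ultimately show ?thesis
          unfolding lie_algebraD(6)[OF lie, of k y ?v] by (rule subspace_add[OF less.prems(3)])
      qed
      then show ?case using Suc less.prems(6) y(1) by simp
    qed
    obtain n where "(br y ^^ n) w = 0" using less.prems(2)[OF y(1)] by blast
    then have ex: "(br y ^^ n) w \<in> U" using subspace_0[OF less.prems(3)] by simp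
    \<comment> \<open>The last iterate of \<open>w\<close> under \<open>br y\<close> outside
      \<open>U\<close> is killed modulo \<open>U\<close> by \<open>y\<close> as well as by
      \<open>K\<close>. As \<open>w\<close> is outside \<open>U\<close>, the index \<open>i\<close>
      is positive.\<close>
    define i where "i = (LEAST i. (br y ^^ i) w \<in> U)"
    have i: "(br y ^^ i) w \<in> U" unfolding i_def using ex by (rule LeastI)
    then obtain j where j: "i = Suc j" using w(2) by (cases i) auto
    have nj: "(br y ^^ j) w \<notin> U"
      using not_less_Least[of j "\<lambda>i. (br y ^^ i) w \<in> U"] j unfolding i_def by simp
    have "br x ((br y ^^ j) w) \<in> U" if xM: "x \<in> M" for x
    proof -
      obtain k r where x: "x = k + r *\<^sub>R y" "k \<in> K" using xM M_eq by blast
      have "br y ((br y ^^ j) w) \<in> U" using i j by simp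
      then show ?thesis
        unfolding x bilinear_ladd[OF bil] bilinear_lmul[OF bil]
        using inv[of j] x(2) less.prems(3) by (simp add: subspace_add subspace_scale)
    qed
    then show ?thesis using nj inv[of j] by blast
  qed
qed

text \<open>Engel's theorem makes a maximal proper subalgebra \<open>K\<close> normalised by some
  \<open>y\<close> outside it; then \<open>M\<close> is \<open>K\<close> plus the line of
  \<open>y\<close>, and every bracket lies in \<open>K\<close>.\<close>

lemma ad_nilpotent_not_perfect:
  fixes M :: "'a::real_vector set"
  assumes fd: "fin_dim TYPE('a)" and lie: "lie_algebra br"
    and M: "lie_subalgebra br M" "M \<noteq> {0}" and nil: "\<And>x. x \<in> M \<Longrightarrow> \<exists>n. \<forall>w. (br x ^^ n) w = 0"
  shows "span {br a b | a b. a \<in> M \<and> b \<in> M} \<noteq> M"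
proof -
  have sM: "subspace M" using M(1) unfolding lie_subalgebra_def by blast
  obtain K where K: "lie_subalgebra br K" "K \<subset> M"
    and max: "\<And>L. \<lbrakk>lie_subalgebra br L; K \<subset> L; L \<subseteq> M\<rbrakk> \<Longrightarrow> L = M"
    using lie_subalgebra_has_maximal[OF fd sM M(2) lie] by blast
  have sK: "subspace K" using K(1) unfolding lie_subalgebra_def by blast
  have "\<exists>y\<in>M - K. \<forall>x\<in>K. br x y \<in> K"
  proof (rule engel_common_vector[OF fd lie K(1)])
    show "\<exists>n. \<forall>w. (br x ^^ n) w = 0" if "x \<in> K" for x
      using nil that K(2) by blast
    show "br x u \<in> K" if "x \<in> K" "u \<in> K" for x u
      using that K(1) unfolding lie_subalgebra_def by blast
    show "br x u \<in> M" if "x \<in> K" "u \<in> M" for x u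
      using that K(2) M(1) unfolding lie_subalgebra_def by blast
  qed fact+
  then obtain y where y: "y \<in> M" "y \<notin> K" "\<And>k. k \<in> K \<Longrightarrow> br k y \<in> K" by blast
  have M_eq: "M = {k + r *\<^sub>R y | k r. k \<in> K}"
    by (rule maximal_subalgebra_normalised[OF lie K sM max y])
  have "{br a b | a b. a \<in> M \<and> b \<in> M} \<subseteq> K"
    using lie_subalgebra_insert(2)[OF lie K(1) y(3)] M_eq by blast
  then have "span {br a b | a b. a \<in> M \<and> b \<in> M} \<subseteq> K" using sK by (rule span_minimal)
  then show ?thesis using K(2) by blast
qed

section \<open>The Killing form\<close>

lemma fin_dim_prod:
  assumes "fin_dim TYPE('a::real_vector)"
  shows "fin_dim TYPE('a \<times> 'a)"
proof -
  obtain B :: "'a set" where B: "finite B" "span B = UNIV" using assms unfolding fin_dim_def by blast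
  let ?C = "(\<lambda>u. (u, 0)) ` B \<union> (\<lambda>u. (0, u)) ` B :: ('a \<times> 'a) set"
  have lin: "linear (\<lambda>u::'a. (u, 0::'a))" "linear (\<lambda>u::'a. (0::'a, u))" by (auto intro!: linearI)
  have "w \<in> span ?C" for w
  proof -
    have sub: "span ((\<lambda>u. (u, 0)) ` B) \<subseteq> span ?C" "span ((\<lambda>u. (0, u)) ` B) \<subseteq> span ?C"
      by (rule span_mono, blast)+
    have "(fst w, 0) \<in> span ?C"
      by (rule subsetD[OF sub(1)]) (simp add: linear_span_image[OF lin(1)] B(2))
    moreover have "(0, snd w) \<in> span ?C"
      by (rule subsetD[OF sub(2)]) (simp add: linear_span_image[OF lin(2)] B(2))
    ultimately have "(fst w, 0) + (0, snd w) \<in> span ?C" by (rule span_add)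
    then show ?thesis by simp
  qed
  then have "span ?C = UNIV" by (intro UNIV_eq_I[symmetric])
  moreover have "finite ?C" using B(1) by simp
  ultimately show ?thesis unfolding fin_dim_def by (intro exI conjI)
qed

text \<open>The trace of a two-by-two block matrix is the sum of the traces of its diagonal
  blocks.\<close>

lemma tr_prod:
  fixes F :: "'a::real_vector \<times> 'a \<Rightarrow> 'a \<times> 'a"
  assumes B: "is_basis B" and C: "is_basis C" and F: "linear F"
  shows "tr C F = tr B (\<lambda>u. fst (F (u, 0))) + tr B (\<lambda>u. snd (F (0, u)))"
proof -
  have lin: "linear (\<lambda>u::'a. (u, 0::'a))" "linear (\<lambda>u::'a. (0::'a, u))" by (auto intro!: linearI)
  have linF: "linear (\<lambda>w. fst (F w))" "linear (\<lambda>w. snd (F w))"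
    using linear_compose[OF F linear_fst] linear_compose[OF F linear_snd] by (simp_all add: o_def)
  have "tr C F = tr C (\<lambda>w. (fst (F w), 0) + (0, snd (F w)))" by simp
  also have "\<dots> = tr C (\<lambda>w. (fst (F w), 0)) + tr C (\<lambda>w. (0, snd (F w)))" by (rule tr_add[OF C])
  also have "tr C (\<lambda>w. (fst (F w), 0)) = tr B (\<lambda>u. fst (F (u, 0)))"
    by (rule tr_commute[OF C B linF(1) lin(1)])
  also have "tr C (\<lambda>w. (0, snd (F w))) = tr B (\<lambda>u. snd (F (0, u)))"
    by (rule tr_commute[OF C B linF(2) lin(2)])
  finally show ?thesis .
qed

text \<open>The pair \<open>u\<close> stands for \<open>fst u + i snd u\<close>, and the bracket is
  extended complex-bilinearly; \<open>imult\<close> below is multiplication by i.\<close>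

definition complexify :: "('a::real_vector \<Rightarrow> 'a \<Rightarrow> 'a) \<Rightarrow> 'a \<times> 'a \<Rightarrow> 'a \<times> 'a \<Rightarrow> 'a \<times> 'a" where
  "complexify br u v = (br (fst u) (fst v) - br (snd u) (snd v), br (fst u) (snd v) + br (snd u) (fst v))"

definition imult :: "'a::real_vector \<times> 'a \<Rightarrow> 'a \<times> 'a" where
  "imult w = (- snd w, fst w)"

lemma bilinear_complexify:
  assumes "bilinear br" shows "bilinear (complexify br)"
  unfolding bilinear_def complexify_def
  by (auto intro!: linearI simp: bilinear_ladd[OF assms] bilinear_radd[OF assms]
      bilinear_lmul[OF assms] bilinear_rmul[OF assms] algebra_simps)

lemma complexify_imult:
  assumes "bilinear br"
  shows "complexify br (imult u) v = imult (complexify br u v)"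
    and "complexify br u (imult v) = imult (complexify br u v)"
  by (simp_all add: complexify_def imult_def bilinear_lneg[OF assms] bilinear_rneg[OF assms])

lemma complexify_derivation:
  assumes "bilinear br" "is_derivation br \<delta>"
  shows "map_prod \<delta> \<delta> (complexify br u v)
    = complexify br (map_prod \<delta> \<delta> u) v + complexify br u (map_prod \<delta> \<delta> v)"
proof -
  have "linear \<delta>" and d: "\<And>x y. \<delta> (br x y) = br (\<delta> x) y + br x (\<delta> y)"
    using assms(2) unfolding is_derivation_def by auto
  then show ?thesis
    by (simp add: complexify_def map_prod_def split_beta linear_add linear_diff d)
qed

lemma ad_is_derivation:
  assumes "lie_algebra br" shows "is_derivation br (br x)"
  unfolding is_derivation_def using lie_algebraD(4,6)[OF assms] by blast

lemma complexify_real: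
  assumes "bilinear br"
  shows "complexify br (x, 0) = map_prod (br x) (br x)"
  by (simp add: complexify_def fun_eq_iff bilinear_lzero[OF assms])

section \<open>Cartan's criterion\<close>

definition killing :: "'a set \<Rightarrow> ('a::real_vector \<Rightarrow> 'a \<Rightarrow> 'a) \<Rightarrow> 'a \<Rightarrow> 'a \<Rightarrow> real" where
  "killing B br x y = tr B (\<lambda>z. br x (br y z))"

text \<open>For \<open>x = [a, b]\<close> and the derivation \<open>S\<close> attached to \<open>ad x\<close>, cyclicity gives
  \<open>tr ([ad a, ad b] S) = - tr (ad a (ad (S b)))\<close>, a value of the Killing form. The traces are
  real traces on the complexification, hence twice the real part of the complex ones.\<close>

lemma cartan_nilpotent:
  fixes br :: "'a::real_vector \<Rightarrow> 'a \<Rightarrow> 'a"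
  assumes B: "is_basis B" and lie: "lie_algebra br"
    and perfect: "span {br a b | a b. a \<in> M \<and> b \<in> M} = M"
    and null: "\<And>x y. x \<in> M \<Longrightarrow> killing B br x y = 0"
    and x: "x \<in> M"
  shows "\<exists>n. \<forall>w. (br x ^^ n) w = 0"
proof -
  note bil = lie_algebraD(1)[OF lie]
  have "fin_dim TYPE('a)" using B unfolding fin_dim_def is_basis_def by blast
  then have fd: "fin_dim TYPE('a \<times> 'a)" by (rule fin_dim_prod)
  then obtain C :: "('a \<times> 'a) set" where C: "is_basis C" by (rule fin_dim_basis)
  let ?br = "complexify br"
  let ?T = "map_prod (br x) (br x)"
  have bilc: "bilinear ?br" by (rule bilinear_complexify[OF bil])
  have linc: "linear (?br u)" for u using bilc unfolding bilinear_def by blast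
  interpret complex_endo imult ?T
  proof (intro complex_endo.intro)
    show "linear (imult :: 'a \<times> 'a \<Rightarrow> _)" by (auto intro!: linearI simp: imult_def)
    show "linear ?T" using linc[of "(x, 0)"] unfolding complexify_real[OF bil] .
  qed (simp_all add: imult_def linear_neg[OF lie_algebraD(4)[OF lie]] map_prod_def split_beta prod_eq_iff)
  obtain S where linS: "linear S"
    and derS: "\<And>u v. S (?br u v) = ?br (S u) v + ?br u (S v)"
    and S: "tr C (\<lambda>w. ?T (S w)) = 0 \<Longrightarrow> \<exists>n. \<forall>w. (?T ^^ n) w = 0"
  proof (rule conjugate_semisimple_part[OF fd C])
    fix S
    assume 1: "linear S"
      and 2: "\<And>\<beta> u v. \<lbrakk>bilinear \<beta>; \<And>u v. \<beta> (imult u) v = imult (\<beta> u v); \<And>u v. \<beta> u (imult v) = imult (\<beta> u v);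
        \<And>u v. ?T (\<beta> u v) = \<beta> (?T u) v + \<beta> u (?T v)\<rbrakk> \<Longrightarrow> S (\<beta> u v) = \<beta> (S u) v + \<beta> u (S v)"
      and 3: "tr C (\<lambda>w. ?T (S w)) = 0 \<Longrightarrow> \<exists>n. \<forall>w. (?T ^^ n) w = 0"
    show thesis
      by (rule that[OF 1 2[OF bilc complexify_imult[OF bil]
              complexify_derivation[OF bil ad_is_derivation[OF lie]]] 3])
  qed
  have comm: "tr C (\<lambda>w. ?br (br a b, 0) (S w)) = 0" if "a \<in> M" "b \<in> M" for a b
  proof -
    let ?A = "?br (a, 0)" and ?Bb = "?br (b, 0)"
    have linAS: "linear (\<lambda>w. ?A (S w))" using linear_compose[OF linS linc] by (simp add: o_def)
    have ab: "?br (br a b, 0) w = ?A (?Bb w) - ?Bb (?A w)" for w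
      using lie_algebraD(6)[OF lie, of a b "fst w"] lie_algebraD(6)[OF lie, of a b "snd w"]
      unfolding complexify_real[OF bil] by (simp add: map_prod_def split_beta)
    have "tr C (\<lambda>w. ?br (br a b, 0) (S w)) = tr C (\<lambda>w. ?A (?Bb (S w))) - tr C (\<lambda>w. ?Bb (?A (S w)))"
      unfolding ab by (rule tr_diff[OF C])
    also have "tr C (\<lambda>w. ?Bb (?A (S w))) = tr C (\<lambda>w. ?A (S (?Bb w)))"
      by (rule tr_commute[OF C C linAS linc])
    also have "tr C (\<lambda>w. ?A (?Bb (S w))) - \<dots> = tr C (\<lambda>w. ?A (?Bb (S w)) - ?A (S (?Bb w)))"
      by (rule tr_diff[OF C, symmetric])
    \<comment> \<open>As \<open>S\<close> is a derivation, its commutator with the action of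
      \<open>b\<close> is the action of \<open>S (b, 0)\<close>.\<close>
    also have "\<dots> = tr C (\<lambda>w. (-1) *\<^sub>R ?A (?br (S (b, 0)) w))"
      unfolding derS linear_add[OF linc] by simp
    also have "\<dots> = - tr C (\<lambda>w. ?A (?br (S (b, 0)) w))"
      unfolding tr_scale[OF C] by simp
    also have "tr C (\<lambda>w. ?A (?br (S (b, 0)) w)) = 0"
    proof -
      have lin: "linear (\<lambda>w. ?A (?br (S (b, 0)) w))"
        using linear_compose[OF linc linc] by (simp add: o_def)
      show ?thesis
        \<comment> \<open>Both diagonal blocks are \<open>br a\<close> composed with bracketing by
          the real part of \<open>S (b, 0)\<close>, so each trace is a Killing value with first
          argument in \<open>M\<close>.\<close>
        unfolding tr_prod[OF B C lin]
        using null[OF that(1), of "fst (S (b, 0))"]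
        unfolding complexify_real[OF bil] killing_def
        by (simp add: complexify_def bilinear_lzero[OF bil] bilinear_rzero[OF bil])
    qed
    finally show ?thesis by simp
  qed
  have "tr C (\<lambda>w. ?br (y, 0) (S w)) = 0" if "y \<in> span {br a b | a b. a \<in> M \<and> b \<in> M}" for y
    using that
  proof (induction rule: span_induct_alt)
    case base
    then show ?case by (simp add: bilinear_lzero[OF bilc] tr_zero flip: zero_prod_def)
  next
    case (step c z y)
    then have z: "tr C (\<lambda>w. ?br (z, 0) (S w)) = 0" using comm by blast
    have "?br (c *\<^sub>R z + y, 0) w = c *\<^sub>R ?br (z, 0) w + ?br (y, 0) w" for w
      unfolding bilinear_lmul[OF bilc, symmetric] bilinear_ladd[OF bilc, symmetric] by simp
    then show ?case using z step by (simp add: tr_add[OF C] tr_scale[OF C])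
  qed
  then have "tr C (\<lambda>w. ?T (S w)) = 0" using x perfect unfolding complexify_real[OF bil, symmetric] by blast
  then obtain n where n: "\<And>w. (?T ^^ n) w = 0" using S by blast
  have "fst ((?T ^^ k) w) = (br x ^^ k) (fst w)" for k w by (induction k) auto
  then have "(br x ^^ n) w = 0" for w using n[of "(w, 0)"] by (metis fst_conv fst_zero)
  then show ?thesis by blast
qed

section \<open>Invariance and nondegeneracy of the Killing form\<close>

lemma killing_linear:
  assumes "is_basis B" "lie_algebra br"
  shows "linear (\<lambda>x. killing B br x y)" "linear (killing B br x)"
proof -
  note bil = lie_algebraD(1)[OF assms(2)]
  show "linear (\<lambda>x. killing B br x y)" "linear (killing B br x)"
    by (auto intro!: linearI simp: killing_def bilinear_ladd[OF bil] bilinear_lmul[OF bil]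
        bilinear_radd[OF bil] bilinear_rmul[OF bil] tr_add[OF assms(1)] tr_scale[OF assms(1)])
qed

text \<open>Cyclicity moves \<open>Y\<close> from the front of \<open>Y X Z\<close> to its end. This
  gives both the invariance of the Killing form and the orthogonality argument for
  derivations.\<close>

lemma tr_commutator_cycle:
  assumes B: "is_basis B" and "linear X" "linear Y" "linear Z"
  shows "tr B (\<lambda>w. X (Y (Z w)) - Y (X (Z w))) = tr B (\<lambda>w. X (Y (Z w)) - X (Z (Y w)))"
proof -
  have "linear (\<lambda>w. X (Z w))" using linear_compose[OF assms(4,2)] by (simp add: o_def)
  from tr_commute[OF B B this assms(3)] show ?thesis unfolding tr_diff[OF B] by simp
qed

lemma ad_bracket:
  assumes "lie_algebra br"
  shows "br (br x y) z = br x (br y z) - br y (br x z)"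
  using lie_algebraD(6)[OF assms, of x y z] by simp

lemma killing_invariant:
  assumes "is_basis B" and lie: "lie_algebra br"
  shows "killing B br (br x y) z = killing B br x (br y z)"
  using tr_commutator_cycle[OF assms(1) lie_algebraD(4)[OF lie] lie_algebraD(4)[OF lie] lie_algebraD(4)[OF lie]]
  unfolding killing_def by (simp add: ad_bracket[OF lie] linear_diff[OF lie_algebraD(4)[OF lie]])

lemma derived_series_subalgebra:
  assumes lie: "lie_algebra br" and K: "lie_subalgebra br K"
  shows "lie_subalgebra br (derived_series br K k) \<and> derived_series br K (Suc k) \<subseteq> derived_series br K k"
proof (induction k)
  case 0
  have "subspace K" "{br a b | a b. a \<in> K \<and> b \<in> K} \<subseteq> K" using K unfolding lie_subalgebra_def by blast+
  then show ?case using K by (simp add: span_minimal)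
next
  case (Suc k)
  let ?D = "derived_series br K"
  have sub: "?D (Suc k) \<subseteq> ?D k" using Suc by blast
  have "br a b \<in> ?D (Suc k)" if "a \<in> ?D (Suc k)" "b \<in> ?D (Suc k)" for a b
  proof -
    have "br a b \<in> {br a b | a b. a \<in> ?D k \<and> b \<in> ?D k}" using that sub by blast
    then show ?thesis unfolding derived_series.simps by (rule span_base)
  qed
  moreover have "subspace (?D (Suc k))" by simp
  ultimately have "lie_subalgebra br (?D (Suc k))" unfolding lie_subalgebra_def by blast
  moreover have "?D (Suc (Suc k)) \<subseteq> ?D (Suc k)"
    unfolding derived_series.simps(2)[of br K "Suc k"]
    using calculation unfolding lie_subalgebra_def by (intro span_minimal) blast+
  ultimately show ?case by blast
qed

theorem killing_nondegenerate:
  fixes br :: "'a::real_vector \<Rightarrow> 'a \<Rightarrow> 'a"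
  assumes B: "is_basis B" and ss: "semisimple_lie br" and x: "\<And>y. killing B br x y = 0"
  shows "x = 0"
proof -
  have lie: "lie_algebra br" using ss unfolding semisimple_lie_def by blast
  have fd: "fin_dim TYPE('a)" using B unfolding fin_dim_def is_basis_def by blast
  define K where "K = {x. \<forall>y. killing B br x y = 0}"
  have sK: "subspace K"
    unfolding K_def subspace_def
    by (simp add: linear_0[OF killing_linear(1)[OF B lie]] linear_add[OF killing_linear(1)[OF B lie]]
        linear_scale[OF killing_linear(1)[OF B lie]])
  have ideal': "br i z \<in> K" if "i \<in> K" for i z
    using that killing_invariant[OF B lie] unfolding K_def by simp
  have ideal: "br z i \<in> K" if "i \<in> K" for i z
    using subspace_neg[OF sK ideal'[OF that]] lie_algebraD(2)[OF lie, of z i] by simp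
  have "lie_ideal br K" unfolding lie_ideal_def using sK ideal by blast
  moreover have "solvable_lie br K"
  proof -
    let ?D = "derived_series br K"
    have KS: "lie_subalgebra br K" unfolding lie_subalgebra_def using sK ideal by blast
    note D = derived_series_subalgebra[OF lie KS]
    \<comment> \<open>The stable term of the derived series is perfect and lies in the kernel; if
      nonzero, it would be both ad-nilpotent and perfect.\<close>
    obtain k where k: "?D (Suc k) = ?D k"
      using subspace_decseq_stabilises[OF fd, of ?D] D unfolding lie_subalgebra_def by blast
    have "?D j \<subseteq> K" for j
      by (induction j) (use D in \<open>auto simp del: derived_series.simps(2)\<close>)
    then have null: "killing B br z y = 0" if "z \<in> ?D k" for z y using that unfolding K_def by blast
    have perfect: "span {br a b | a b. a \<in> ?D k \<and> b \<in> ?D k} = ?D k" using k by simp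
    have "?D k = {0}"
      using ad_nilpotent_not_perfect[OF fd lie _ _ cartan_nilpotent[OF B lie perfect null]] D perfect by blast
    then show ?thesis unfolding solvable_lie_def by blast
  qed
  ultimately have "K = {0}" using ss unfolding semisimple_lie_def by blast
  then show ?thesis using x unfolding K_def by blast
qed

section \<open>Duality and inner derivations\<close>

lemma fin_dim_linear_inj_imp_surj:
  fixes F :: "'a::real_vector \<Rightarrow> 'a"
  assumes B: "is_basis (B :: 'a set)" and F: "linear F" and inj: "inj F"
  shows "surj F"
proof -
  have fd: "fin_dim TYPE('a)" using B unfolding fin_dim_def is_basis_def by blast
  have ind: "independent B" and sp: "span B = UNIV" using B unfolding is_basis_def by blast+
  have "inj_on F (span B)" unfolding sp by (rule inj)
  then have ind': "independent (F ` B)" by (rule linear_independent_injective_image[OF F ind])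
  have rg: "range F = span (F ` B)" using linear_span_image[OF F, of B] unfolding sp by (rule sym)
  have c1: "card (F ` B) = dim (range F)"
    by (rule real_vector.basis_card_eq_dim) (use rg ind' in \<open>simp_all only: order_refl span_superset simp_thms\<close>)
  have c2: "card B = dim (UNIV :: 'a set)"
    by (rule real_vector.basis_card_eq_dim[OF subset_UNIV _ ind]) (simp only: sp order_refl)
  have c3: "card (F ` B) = card B" by (rule card_image[OF inj_on_subset[OF inj subset_UNIV]])
  have sub: "subspace (range F)" unfolding rg by (rule subspace_span)
  show ?thesis
  proof (rule ccontr)
    assume "range F \<noteq> UNIV"
    then have "range F \<subset> UNIV" by (simp only: psubset_eq subset_UNIV simp_thms)
    from dim_strict_mono[OF fd sub subspace_UNIV this] show False using c1 c2 c3 by linarith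
  qed
qed

text \<open>Nondegeneracy makes the map from vectors to functionals injective. Recording a
  functional by its values on \<open>B\<close> turns this map into an endomorphism \<open>F\<close>,
  which is then surjective.\<close>

lemma killing_represents:
  fixes \<phi> :: "'a::real_vector \<Rightarrow> real"
  assumes B: "is_basis B" and ss: "semisimple_lie br" and \<phi>: "linear \<phi>"
  obtains x where "\<And>y. killing B br x y = \<phi> y"
proof -
  have lie: "lie_algebra br" using ss unfolding semisimple_lie_def by blast
  have fin: "finite B" and ind: "independent B" using B unfolding is_basis_def by blast+
  have coords: "f b = g b" if "(\<Sum>b\<in>B. f b *\<^sub>R b) = (\<Sum>b\<in>B. g b *\<^sub>R b)" "b \<in> B" for f g b
  proof -
    have "(\<Sum>b\<in>B. (f b - g b) *\<^sub>R b) = 0" using that(1) by (simp add: scaleR_diff_left sum_subtractf)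
    from real_vector.independentD[OF ind fin order_refl this that(2)] show ?thesis by simp
  qed
  have ext: "\<psi> y = \<psi>' y" if "linear \<psi>" "linear \<psi>'" "\<And>b. b \<in> B \<Longrightarrow> \<psi> b = \<psi>' b" for \<psi> \<psi>' :: "'a \<Rightarrow> real" and y
    using linear_basis_expansion[OF B that(1), of y] linear_basis_expansion[OF B that(2), of y] that(3)
    by simp
  define F where "F x = (\<Sum>b\<in>B. killing B br x b *\<^sub>R b)" for x
  have linF: "linear F"
    by (intro linearI) (simp_all add: F_def linear_add[OF killing_linear(1)[OF B lie]]
        linear_scale[OF killing_linear(1)[OF B lie]] scaleR_add_left sum.distrib scaleR_sum_right)
  have "x = 0" if "F x = 0" for x
  proof (rule killing_nondegenerate[OF B ss])
    have "killing B br x b = 0" if "b \<in> B" for b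
      using coords[of "killing B br x" "\<lambda>_. 0" b] \<open>F x = 0\<close> that unfolding F_def by simp
    then show "killing B br x y = 0" for y
      by (rule ext[OF killing_linear(2)[OF B lie] module_hom_zero])
  qed
  then have "inj F" using linear_injective_0[OF linF] by blast
  then have "surj F" by (rule fin_dim_linear_inj_imp_surj[OF B linF])
  then obtain x where x: "F x = (\<Sum>b\<in>B. \<phi> b *\<^sub>R b)" by (metis surj_def)
  have "killing B br x y = \<phi> y" for y
    by (rule ext[OF killing_linear(2)[OF B lie] \<phi> coords[OF x[unfolded F_def]]])
  then show thesis by (rule that)
qed

text \<open>Choose \<open>x\<close> so that \<open>br x\<close> and \<open>\<delta>\<close> have
  equal traces against every \<open>br y\<close>. The difference \<open>E\<close> is a derivation
  orthogonal to all inner ones, and nondegeneracy forces it to vanish.\<close>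

theorem derivation_inner:
  fixes br :: "'a::real_vector \<Rightarrow> 'a \<Rightarrow> 'a"
  assumes fd: "fin_dim TYPE('a)" and ss: "semisimple_lie br" and \<delta>: "is_derivation br \<delta>"
  obtains x where "\<And>y. \<delta> y = br x y"
proof -
  have lie: "lie_algebra br" using ss unfolding semisimple_lie_def by blast
  note bil = lie_algebraD(1)[OF lie] and lin = lie_algebraD(4)[OF lie]
  obtain B :: "'a set" where B: "is_basis B" using fin_dim_basis[OF fd] .
  have lin\<delta>: "linear \<delta>" and der: "\<And>x y. \<delta> (br x y) = br (\<delta> x) y + br x (\<delta> y)"
    using \<delta> unfolding is_derivation_def by auto
  have trlin: "linear (\<lambda>y. tr B (\<lambda>z. \<delta> (br y z)))"
    by (intro linearI) (simp_all add: bilinear_ladd[OF bil] bilinear_lmul[OF bil] linear_add[OF lin\<delta>]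
        linear_scale[OF lin\<delta>] tr_add[OF B] tr_scale[OF B])
  obtain x where x: "\<And>y. killing B br x y = tr B (\<lambda>z. \<delta> (br y z))"
    using killing_represents[OF B ss trlin] by blast
  define E where "E y = \<delta> y - br x y" for y
  have linE: "linear E" unfolding E_def by (intro linear_compose_sub lin\<delta> lin)
  have trE: "tr B (\<lambda>z. E (br y z)) = 0" for y
    using x[of y] unfolding E_def tr_diff[OF B] killing_def by simp
  \<comment> \<open>The adjoint map of \<open>E y\<close> is the commutator of \<open>E\<close> with
    \<open>br y\<close>; this lets traces against \<open>E\<close> express Killing values.\<close>
  have adE: "br (E y) z = E (br y z) - br y (E z)" for y z
    unfolding E_def der bilinear_lsub[OF bil] bilinear_rsub[OF bil] lie_algebraD(6)[OF lie, of x y z] by simp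
  have "E y = 0" for y
  proof (rule killing_nondegenerate[OF B ss])
    fix z
    have "killing B br (E y) z = tr B (\<lambda>w. E (br y (br z w)) - br y (E (br z w)))"
      unfolding killing_def adE ..
    also have "\<dots> = tr B (\<lambda>w. E (br y (br z w)) - E (br z (br y w)))"
      by (rule tr_commutator_cycle[OF B linE lin lin])
    also have "\<dots> = tr B (\<lambda>w. E (br (br y z) w))"
      unfolding ad_bracket[OF lie] linear_diff[OF linE] ..
    also have "\<dots> = 0" by (rule trE)
    finally show "killing B br (E y) z = 0" .
  qed
  then show thesis using that[of x] unfolding E_def by simp
qed

section \<open>Trivial centre and the Rota-Baxter operator\<close>

lemma semisimple_centerless:
  assumes ss: "semisimple_lie br" and z: "\<And>y. br z y = 0"
  shows "z = 0"
proof -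
  have lie: "lie_algebra br" using ss unfolding semisimple_lie_def by blast
  note bil = lie_algebraD(1)[OF lie]
  define Z where "Z = {z. \<forall>y. br z y = 0}"
  have sub: "subspace Z"
    unfolding Z_def subspace_def
    by (simp add: bilinear_lzero[OF bil] bilinear_ladd[OF bil] bilinear_lmul[OF bil])
  have zero: "br x i = 0" if "i \<in> Z" for x i
    using that lie_algebraD(2)[OF lie, of x i] unfolding Z_def by simp
  have "lie_ideal br Z" unfolding lie_ideal_def using sub zero subspace_0[OF sub] by simp
  \<comment> \<open>The centre is abelian, so its derived series ends after one step.\<close>
  moreover have "derived_series br Z 1 = {0}"
  proof -
    have "{br a b | a b. a \<in> Z \<and> b \<in> Z} \<subseteq> {0}" using zero by blast
    from span_minimal[OF this subspace_single_0] show ?thesis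
      using span_0[of "{br a b | a b. a \<in> Z \<and> b \<in> Z}"] unfolding One_nat_def derived_series.simps by blast
  qed
  ultimately have "Z = {0}" using ss unfolding semisimple_lie_def solvable_lie_def by blast
  then show ?thesis using z unfolding Z_def by blast
qed

theorem theorem5p10:
  fixes br circ :: "'a::real_vector \<Rightarrow> 'a \<Rightarrow> 'a"
  assumes "fin_dim TYPE('a)"
    and "semisimple_lie br"
    and "postlie br circ"
  shows "\<exists>f. rota_baxter br 1 f \<and> (\<forall>x y. circ x y = br (f x) y)"
proof -
  have lie: "lie_algebra br" and bilc: "bilinear circ"
    and act: "\<And>x y z. circ z (circ y x) - circ y (circ z x) + circ (circ y z) x
                 - circ (circ z y) x + circ (br y z) x = 0"
    and der: "\<And>x y z. circ z (br x y) - br (circ z x) y - br x (circ z y) = 0"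
    using assms(3) unfolding postlie_def by blast+
  note bil = lie_algebraD(1)[OF lie]
  have d: "is_derivation br (circ z)" for z
  proof -
    have "linear (circ z)" using bilc unfolding bilinear_def by blast
    moreover have "circ z (br x y) = br (circ z x) y + br x (circ z y)" for x y
      using der[of z x y] by (simp only: diff_diff_eq eq_iff_diff_eq_0[symmetric])
    ultimately show ?thesis unfolding is_derivation_def by blast
  qed
  have "\<exists>u. \<forall>y. circ z y = br u y" for z
    using derivation_inner[OF assms(1,2) d[of z]] by blast
  \<comment> \<open>Here \<open>f\<close> is only a pointwise choice; the trivial centre makes it
    unique and hence linear.\<close>
  then obtain f where f: "\<And>x y. circ x y = br (f x) y" by metis
  have eqI: "u = v" if "\<And>y. br u y = br v y" for u v
  proof -
    have "u - v = 0"
      by (rule semisimple_centerless[OF assms(2)]) (simp only: bilinear_lsub[OF bil] that diff_self)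
    then show ?thesis by simp
  qed
  have "linear f"
  proof (rule linearI; rule eqI)
    show "br (f (a + b)) y = br (f a + f b) y" for a b y
      by (simp add: bilinear_ladd[OF bil] bilinear_ladd[OF bilc] flip: f)
    show "br (f (r *\<^sub>R a)) y = br (r *\<^sub>R f a) y" for r a y
      by (simp add: bilinear_lmul[OF bil] bilinear_lmul[OF bilc] flip: f)
  qed
  moreover have "br (f x) (f y) = f (br (f x) y + br x (f y) + 1 *\<^sub>R br x y)" for x y
  proof (rule eqI)
    fix w
    \<comment> \<open>Antisymmetry turns the argument of \<open>f\<close> on the right-hand side
      into \<open>circ x y - circ y x + br x y\<close>.\<close>
    have "br x (f y) = - circ y x" using lie_algebraD(2)[OF lie, of x "f y"] by (simp add: f)
    then have "br (f (br (f x) y + br x (f y) + 1 *\<^sub>R br x y)) w = circ (circ x y - circ y x + br x y) w"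
      by (simp flip: f)
    also have "\<dots> = circ (circ x y) w - circ (circ y x) w + circ (br x y) w"
      by (simp add: bilinear_ladd[OF bilc] bilinear_lsub[OF bilc])
    \<comment> \<open>The PostLie axiom identifies left multiplication by that element with the
      commutator of the left multiplications by \<open>x\<close> and \<open>y\<close>.\<close>
    also have "\<dots> = circ x (circ y w) - circ y (circ x w)"
      using act[of y x w] by (simp add: algebra_simps)
    also have "\<dots> = br (br (f x) (f y)) w"
      by (simp add: f ad_bracket[OF lie])
    finally show "br (br (f x) (f y)) w = br (f (br (f x) y + br x (f y) + 1 *\<^sub>R br x y)) w" ..
  qed
  ultimately show ?thesis using f unfolding rota_baxter_def by blast
qed

end
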